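(* Let $K,L\in\mathcal K^n_o$ and let $\omega\subset S^{n-1}$ be any set. Then the map $t\mapsto\boldsymbol\alpha_{K\hat+_tL}(\omega)$ from $[0,1]$ to subsets of $S^{n-1}$ equipped with the Hausdorff distance $d_H$ is Lipschitz continuous; more precisely, for all $t_1,t_2\in[0,1]$, $$d_H\big(\boldsymbol\alpha_{K\hat+_{t_1}L}(\omega),\boldsymbol\alpha_{K\hat+_{t_2}L}(\omega)\big)\le 2\max\Big(\frac{R_K}{r_K},\frac{R_L}{r_L}\Big)\max\Big(\frac{R_K}{r_L},\frac{R_L}{r_K}\Big)|t_1-t_2| .$$
   Context: $\mathcal K^n_o$ is the set of convex bodies (compact convex sets with nonempty interior) in $\mathbb R^n$ containing the origin in their interior. For $K\in\mathcal K^n_o$, let $R_K$ be the radius of the smallest ball centered at the origin containing $K$, and $r_K$ the radius of the largest ball centered at the origin contained in $K$. For $x\in\partial K$, $N(K,x)=\{v\in S^{n-1}:(y-x)\cdot v\le 0\text{ for all }y\in K\}$; for $\omega\subset S^{n-1}$ the radial Gauss image is $\boldsymbol\alpha_K(\omega)=\bigcup N(K,x)$, the union over all $x\in\partial K$ of the form $x=su$ with $s>0$, $u\in\omega$. $K^*$ is the polar body of $K$. For $t\in[0,1]$ the harmonic mean is $K\hat+_tL:=((1-t)K^*+tL^* )^*$ (Minkowski sum). On $S^{n-1}$ use the arc distance $d(u,v)=\arccos(u\cdot v)$, $d(u,\omega)=\inf_{v\in\omega}d(u,v)$, and the Hausdorff distance $d_H(\omega_1,\omega_2)=\max\big(\sup_{u\in\omega_1}d(u,\omega_2),\sup_{u\in\omega_2}d(u,\omega_1)\big)$.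 *)

theory Defs
  imports "HOL-Analysis.Analysis" "HOL-Library.Set_Algebras"
begin

definition convex_body_o :: "'a::euclidean_space set \<Rightarrow> bool" where
  "convex_body_o K \<longleftrightarrow> compact K \<and> convex K \<and> 0 \<in> interior K"

definition outradius_o :: "'a::euclidean_space set \<Rightarrow> real" where
  "outradius_o K = Inf {R. 0 \<le> R \<and> K \<subseteq> cball 0 R}"

definition inradius_o :: "'a::euclidean_space set \<Rightarrow> real" where
  "inradius_o K = Sup {r. 0 \<le> r \<and> cball 0 r \<subseteq> K}"

definition unit_normals :: "'a::euclidean_space set \<Rightarrow> 'a \<Rightarrow> 'a set" where
  "unit_normals K x = {v \<in> sphere 0 1. \<forall>y\<in>K. (y - x) \<bullet> v \<le> 0}"

definition radial_gauss_image :: "'a::euclidean_space set \<Rightarrow> 'a set \<Rightarrow> 'a set" where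
  "radial_gauss_image K \<omega> =
     (\<Union>x \<in> {x \<in> frontier K. \<exists>s u. 0 < s \<and> u \<in> \<omega> \<and> x = s *\<^sub>R u}. unit_normals K x)"

definition polar_body :: "'a::euclidean_space set \<Rightarrow> 'a set" where
  "polar_body K = {y. \<forall>x\<in>K. x \<bullet> y \<le> 1}"

text \<open>The sum of sets below is the Minkowski sum.\<close>

definition harmonic_mean :: "real \<Rightarrow> 'a::euclidean_space set \<Rightarrow> 'a set \<Rightarrow> 'a set" where
  "harmonic_mean t K L =
     polar_body ((*\<^sub>R) (1 - t) ` polar_body K + (*\<^sub>R) t ` polar_body L)"

text \<open>Distances between sets take values in \<open>[0, \<infinity>]\<close>, so that the supremum over the
  empty set is \<open>0\<close> and the infimum over it is \<open>\<infinity>\<close>: the Hausdorff distance is \<open>0\<close> between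
  two empty sets and \<open>\<infinity>\<close> between an empty and a nonempty one.\<close>

definition arc_dist :: "'a::euclidean_space \<Rightarrow> 'a \<Rightarrow> real" where
  "arc_dist u v = arccos (u \<bullet> v)"

definition arc_dist_set :: "'a::euclidean_space \<Rightarrow> 'a set \<Rightarrow> ennreal" where
  "arc_dist_set u \<omega> = (INF v\<in>\<omega>. ennreal (arc_dist u v))"

definition arc_hausdorff_dist :: "'a::euclidean_space set \<Rightarrow> 'a set \<Rightarrow> ennreal" where
  "arc_hausdorff_dist \<omega>1 \<omega>2 =
     max (SUP u\<in>\<omega>1. arc_dist_set u \<omega>2) (SUP u\<in>\<omega>2. arc_dist_set u \<omega>1)"

end

theory Submission
  imports Defs
begin

text \<open>
  Write \<open>M\<^sub>t = (1 - t) K\<^sup>* + t L\<^sup>*\<close>. By the bipolar theorem, the normals of \<open>M\<^sub>t\<^sup>*\<close> at its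
  boundary point in direction \<open>u\<close> are the normalised points of the face of \<open>M\<^sub>t\<close> on which
  the inner product with \<open>u\<close> is maximal, and this face is the Minkowski combination of
  those of \<open>K\<^sup>*\<close> and \<open>L\<^sup>*\<close>. So for points \<open>a\<close>, \<open>b\<close> of the latter faces a normal for the
  parameter \<open>t\<close> is the direction of \<open>y t = (1 - t) a + t b\<close>, and it remains to bound the angle
  between \<open>y s\<close> and \<open>y t\<close>. The parallelogram they span has area at most
  \<open>\<bar>s - t\<bar> |a| |b| \<le> \<bar>s - t\<bar> / (r\<^sub>K r\<^sub>L)\<close>, while both have inner product at least
  \<open>1 / max R\<^sub>K R\<^sub>L\<close> with \<open>u\<close>.
\<close>

section \<open>Angle estimates\<close>

text \<open>By concavity, sine lies above its chord over \<open>{0..pi/2}\<close>, so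
  \<open>x \<le> (pi/2) * sin x\<close>; rounding \<open>pi/2\<close> up to 2 gives the
  constant.\<close>

lemma le_two_sin:
  fixes x :: real
  assumes "0 \<le> x" "x \<le> pi / 2"
  shows "x \<le> 2 * sin x"
proof -
  have "concave_on {0..pi/2} (\<lambda>x. sin x :: real)"
  proof (rule f''_le0_imp_concave)
    show "- sin x \<le> 0" if "x \<in> {0..pi/2}" for x :: real
      using that sin_ge_zero[of x] by auto
  qed (auto intro!: derivative_eq_intros)
  from concave_onD[OF this, of "x / (pi/2)" 0 "pi/2"] assms
  have "x / (pi/2) \<le> sin x"
    by (simp add: field_simps)
  then have "x \<le> (pi/2) * sin x"
    by (simp add: field_simps)
  also have "\<dots> \<le> 2 * sin x"
    using assms sin_ge_zero[of x] pi_half_less_two by (intro mult_right_mono) auto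
  finally show ?thesis .
qed

text \<open>
  The angle may be obtuse, so its sine does not control it. Instead, half of it, \<open>h\<close>, is at most
  \<open>2 sin h\<close>, and the lower bound on \<open>cos h\<close> that turns a bound on \<open>sin (2 h)\<close> into one on \<open>sin h\<close>
  comes from \<open>|sgn y + sgn z| = 2 cos h\<close>.
\<close>
lemma arc_dist_sgn_le:
  fixes y z u :: "'a::euclidean_space"
  assumes u: "norm u = 1" and m: "0 < m" "m \<le> y \<bullet> u" "m \<le> z \<bullet> u"
    and A: "0 \<le> A" "(norm y)\<^sup>2 * (norm z)\<^sup>2 - (y \<bullet> z)\<^sup>2 \<le> A\<^sup>2"
  shows "arc_dist (sgn y) (sgn z) \<le> 2 * A / m\<^sup>2"
proof -
  define p q c where "p = norm y" and "q = norm z" and "c = sgn y \<bullet> sgn z"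
  define h where "h = arccos c / 2"
  have le_norm: "x \<bullet> u \<le> norm x" for x
    using norm_cauchy_schwarz[of x u] u by simp
  have pq: "m \<le> p" "m \<le> q"
    using m le_norm[of y] le_norm[of z] unfolding p_def q_def by linarith+
  have "y \<noteq> 0" "z \<noteq> 0"
    using m by auto
  then have norm1: "norm (sgn y) = 1" "norm (sgn z) = 1"
    by (simp_all add: norm_sgn)
  have c: "-1 \<le> c" "c \<le> 1"
    using Cauchy_Schwarz_ineq2[of "sgn y" "sgn z"] norm1 by (auto simp: c_def)
  have h: "0 \<le> h" "h \<le> pi / 2" and ch: "c = cos (2 * h)"
    using arccos_lbound[OF c] arccos_ubound[OF c] cos_arccos[OF c] by (auto simp: h_def)
  have C0: "0 \<le> cos h" and S0: "0 \<le> sin h"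
    using h by (auto intro!: cos_ge_zero sin_ge_zero)
  have "(norm (sgn y + sgn z))\<^sup>2 = 2 + 2 * c"
    using dot_norm[of "sgn y" "sgn z"] norm1 by (simp add: c_def)
  also have "\<dots> = (2 * cos h)\<^sup>2"
    by (simp add: ch cos_double_cos power_mult_distrib)
  finally have "(norm (sgn y + sgn z))\<^sup>2 = (2 * cos h)\<^sup>2" .
  then have "norm (sgn y + sgn z) = 2 * cos h"
    using C0 by (subst (asm) power2_eq_iff_nonneg) auto
  then have "(sgn y + sgn z) \<bullet> u \<le> 2 * cos h"
    using le_norm[of "sgn y + sgn z"] by simp
  \<comment> \<open>Multiplying by \<open>p * q\<close> clears the normalisations, so that the lower
    bounds on \<open>y \<bullet> u\<close> and \<open>z \<bullet> u\<close> apply.\<close>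
  moreover have "(p * q) * ((sgn y + sgn z) \<bullet> u) = q * (y \<bullet> u) + p * (z \<bullet> u)"
    using \<open>y \<noteq> 0\<close> \<open>z \<noteq> 0\<close>
    by (simp add: p_def q_def sgn_div_norm inner_add field_simps)
  moreover have "q * m + p * m \<le> q * (y \<bullet> u) + p * (z \<bullet> u)"
    using m pq by (intro add_mono mult_left_mono) auto
  ultimately have C: "m * (p + q) \<le> p * q * (2 * cos h)"
    using mult_left_mono[of "(sgn y + sgn z) \<bullet> u" "2 * cos h" "p * q"] pq m
    by (simp add: algebra_simps)
  have yz: "y \<bullet> z = p * q * c"
    using \<open>y \<noteq> 0\<close> \<open>z \<noteq> 0\<close> by (simp add: p_def q_def c_def sgn_div_norm field_simps)
  have "(p * q * sin (2 * h))\<^sup>2 = p\<^sup>2 * q\<^sup>2 * (1 - c\<^sup>2)"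
    by (simp add: ch power_mult_distrib sin_squared_eq)
  also have "\<dots> = p\<^sup>2 * q\<^sup>2 - (y \<bullet> z)\<^sup>2"
    by (simp add: yz power_mult_distrib algebra_simps)
  also have "\<dots> \<le> A\<^sup>2"
    using A by (simp add: p_def q_def)
  finally have "p * q * sin (2 * h) \<le> A"
    using A(1) by (rule power2_le_imp_le)
  then have S: "sin h * (p * q * (2 * cos h)) \<le> A"
    unfolding sin_double by (simp add: mult_ac)
  \<comment> \<open>The factor \<open>p * q\<close> of the area is the one in \<open>C\<close>, so
    it is absorbed and the final bound involves the norms only through \<open>m\<close>.\<close>
  have "m * (2 * m) \<le> m * (p + q)"
    using pq m by (intro mult_left_mono) auto
  with C have "2 * m\<^sup>2 \<le> p * q * (2 * cos h)"
    by (simp add: power2_eq_square)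
  from mult_left_mono[OF this S0] S have "sin h * (2 * m\<^sup>2) \<le> A"
    by linarith
  then have "2 * (2 * sin h) \<le> 2 * A / m\<^sup>2"
    using m by (simp add: field_simps)
  with le_two_sin[OF h] show ?thesis
    by (simp add: arc_dist_def h_def flip: c_def)
qed

section \<open>Polar bodies and bipolarity\<close>

lemma closed_polar_body: "closed (polar_body K)"
proof -
  have "polar_body K = (\<Inter>x\<in>K. {y. x \<bullet> y \<le> 1})"
    by (auto simp: polar_body_def)
  then show ?thesis
    by (simp add: closed_INT closed_halfspace_le)
qed

lemma convex_polar_body: "convex (polar_body K)"
proof -
  have "polar_body K = (\<Inter>x\<in>K. {y. x \<bullet> y \<le> 1})"
    by (auto simp: polar_body_def)
  then show ?thesis
    by (simp add: convex_INT convex_halfspace_le)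
qed

text \<open>Tested against the point of length \<open>r\<close> in the direction of
  \<open>y\<close>. The product form also covers \<open>r = 0\<close>, which the set defining
  \<open>inradius_o\<close> contains.\<close>

lemma norm_polar_body_le:
  assumes "cball 0 r \<subseteq> K" "0 \<le> r" "y \<in> polar_body K"
  shows "r * norm y \<le> 1"
proof -
  have "r *\<^sub>R sgn y \<in> K"
    using assms by (intro subsetD[OF assms(1)]) (simp add: norm_sgn)
  with assms(3) have "(r *\<^sub>R sgn y) \<bullet> y \<le> 1"
    by (auto simp: polar_body_def)
  then show ?thesis
    by (cases "y = 0") (auto simp: sgn_div_norm dot_square_norm power2_eq_square field_simps)
qed

lemma cball_subset_polar_body:
  assumes "K \<subseteq> cball 0 R" "0 < R"
  shows "cball 0 (1 / R) \<subseteq> polar_body K"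
proof
  fix y :: 'a assume y: "y \<in> cball 0 (1 / R)"
  have "x \<bullet> y \<le> 1" if "x \<in> K" for x
  proof -
    have "x \<bullet> y \<le> norm x * norm y" by (rule norm_cauchy_schwarz)
    also have "\<dots> \<le> R * (1 / R)"
      using that assms y by (intro mult_mono) auto
    finally show ?thesis using assms by simp
  qed
  then show "y \<in> polar_body K" by (simp add: polar_body_def)
qed

lemma convex_body_oE:
  assumes "convex_body_o K"
  obtains r R where "0 < r" "cball 0 r \<subseteq> K" "0 < R" "K \<subseteq> cball 0 R"
proof -
  from assms obtain r where "0 < r" "cball 0 r \<subseteq> K"
    by (auto simp: convex_body_o_def mem_interior_cball)
  moreover from assms obtain R where "0 < R" "K \<subseteq> cball 0 R"
    by (metis bounded_pos compact_imp_bounded convex_body_o_def mem_cball_0 subsetI)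
  ultimately show thesis using that by blast
qed

lemma convex_body_o_polar_body:
  assumes "convex_body_o K"
  shows "convex_body_o (polar_body K)"
proof -
  from assms obtain r R where *: "0 < r" "cball 0 r \<subseteq> K" "0 < R" "K \<subseteq> cball 0 R"
    by (rule convex_body_oE)
  have "norm y \<le> 1 / r" if "y \<in> polar_body K" for y
    using norm_polar_body_le[of r K y] * that by (simp add: field_simps)
  then have "bounded (polar_body K)"
    by (auto simp: bounded_iff)
  moreover have "0 \<in> interior (polar_body K)"
    using cball_subset_polar_body[OF *(4,3)] *(3)
    by (auto simp: mem_interior_cball intro!: exI[of _ "1/R"])
  ultimately show ?thesis
    by (simp add: convex_body_o_def compact_eq_bounded_closed closed_polar_body convex_polar_body)
qed

lemma polar_body_polar_body:
  fixes M :: "'a::euclidean_space set"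
  assumes "convex M" "closed M" "0 \<in> M"
  shows "polar_body (polar_body M) = M"
proof
  show "M \<subseteq> polar_body (polar_body M)"
    by (auto simp: polar_body_def inner_commute)
  show "polar_body (polar_body M) \<subseteq> M"
  proof (rule subsetI, rule ccontr)
    fix y assume y: "y \<in> polar_body (polar_body M)" "y \<notin> M"
    obtain a b where ab: "a \<bullet> y < b" "\<forall>x\<in>M. a \<bullet> x > b"
      using separating_hyperplane_closed_point[OF assms(1,2) y(2)] by blast
    \<comment> \<open>Since 0 is in \<open>M\<close>, the separating level \<open>b\<close> is
      negative; dividing by it reverses the inequalities and puts \<open>a / b\<close> into the
      polar, where it excludes \<open>y\<close>.\<close>
    have b: "b < 0" using ab(2) assms(3) by auto
    have "x \<bullet> ((1 / b) *\<^sub>R a) \<le> 1" if "x \<in> M" for x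
      using ab(2) b that by (auto simp: inner_commute field_simps intro: less_imp_le)
    then have "(1 / b) *\<^sub>R a \<in> polar_body M"
      by (simp add: polar_body_def)
    then have "((1 / b) *\<^sub>R a) \<bullet> y \<le> 1"
      using y(1) unfolding polar_body_def[of "polar_body M"] by blast
    then have "a \<bullet> y / b \<le> 1"
      by simp
    then show False
      using ab(1) b by (simp add: field_simps)
  qed
qed

section \<open>Exposed faces and Minkowski combinations\<close>

definition support_face :: "'a::euclidean_space set \<Rightarrow> 'a \<Rightarrow> 'a set" where
  "support_face M u = {y \<in> M. \<forall>z\<in>M. z \<bullet> u \<le> y \<bullet> u}"

lemma support_face_nonempty:
  assumes "compact M" "M \<noteq> {}"
  shows "support_face M u \<noteq> {}"
proof -
  have "\<exists>y\<in>M. \<forall>z\<in>M. z \<bullet> u \<le> y \<bullet> u"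
    using assms by (intro continuous_attains_sup) (auto intro!: continuous_intros)
  then show ?thesis by (auto simp: support_face_def)
qed

lemma support_face_ge:
  assumes "cball 0 r \<subseteq> M" "0 \<le> r" "norm u = 1" "y \<in> support_face M u"
  shows "r \<le> y \<bullet> u"
proof -
  have "r *\<^sub>R u \<in> M" using assms by (intro subsetD[OF assms(1)]) auto
  then have "(r *\<^sub>R u) \<bullet> u \<le> y \<bullet> u" using assms(4) by (auto simp: support_face_def)
  then show ?thesis using assms(3) by (simp add: norm_eq_1)
qed

text \<open>A linear functional on a Minkowski sum is maximal exactly when it is maximal on each
  summand of positive weight. A summand of weight 0 can be replaced by any maximiser.\<close>

lemma support_face_minkowski:
  fixes A B :: "'a::euclidean_space set"
  assumes "compact A" "A \<noteq> {}" "compact B" "B \<noteq> {}" "0 \<le> t" "t \<le> 1"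
  shows "support_face ((*\<^sub>R) (1 - t) ` A + (*\<^sub>R) t ` B) u =
    {(1 - t) *\<^sub>R a + t *\<^sub>R b | a b. a \<in> support_face A u \<and> b \<in> support_face B u}"
    (is "support_face ?M u = ?F")
proof (intro equalityI subsetI)
  fix y assume y: "y \<in> support_face ?M u"
  then obtain a b where ab: "a \<in> A" "b \<in> B" "y = (1 - t) *\<^sub>R a + t *\<^sub>R b"
    by (auto simp: support_face_def elim!: set_plus_elim)
  have max: "((1 - t) *\<^sub>R a' + t *\<^sub>R b') \<bullet> u \<le> y \<bullet> u" if "a' \<in> A" "b' \<in> B" for a' b'
    using y that by (auto simp: support_face_def)
  \<comment> \<open>Substitutes for \<open>a\<close> at \<open>t = 1\<close> and for
    \<open>b\<close> at \<open>t = 0\<close>, where the point \<open>y\<close> carries no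
    information on that summand.\<close>
  obtain a0 where a0: "a0 \<in> support_face A u"
    using support_face_nonempty[OF assms(1,2)] by blast
  obtain b0 where b0: "b0 \<in> support_face B u"
    using support_face_nonempty[OF assms(3,4)] by blast
  have A': "a \<in> support_face A u" if "t < 1"
    using max[OF _ ab(2)] ab that by (auto simp: support_face_def inner_add)
  have B': "b \<in> support_face B u" if "0 < t"
    using max[OF ab(1)] ab that by (auto simp: support_face_def inner_add)
  consider "t = 0" | "t = 1" | "0 < t" "t < 1" using assms by linarith
  then show "y \<in> ?F"
  proof cases
    case 1 then show ?thesis using A' ab b0 by force
  next
    case 2 then show ?thesis using B' ab a0 by force
  next
    case 3 then show ?thesis using A' B' ab by blast
  qed
next
  fix y assume "y \<in> ?F"
  then obtain a b where "a \<in> support_face A u" "b \<in> support_face B u"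
    "y = (1 - t) *\<^sub>R a + t *\<^sub>R b" by blast
  then show "y \<in> support_face ?M u"
    using assms by (auto simp: support_face_def inner_add elim!: set_plus_elim
        intro!: add_mono mult_left_mono)
qed

lemma convex_body_o_minkowski:
  fixes A B :: "'a::euclidean_space set"
  assumes A: "convex_body_o A" and B: "convex_body_o B" and t: "0 \<le> t" "t \<le> 1"
  shows "convex_body_o ((*\<^sub>R) (1 - t) ` A + (*\<^sub>R) t ` B)" (is "convex_body_o ?M")
proof -
  obtain r where r: "0 < r" "cball 0 r \<subseteq> A" using A by (rule convex_body_oE)
  obtain s where s: "0 < s" "cball 0 s \<subseteq> B" using B by (rule convex_body_oE)
  \<comment> \<open>The smaller ball lies in both bodies, and each of its points is the convex
    combination of two copies of itself.\<close>
  have "cball 0 (min r s) \<subseteq> ?M"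
  proof
    fix x :: 'a assume "x \<in> cball 0 (min r s)"
    then have "x \<in> A" "x \<in> B" using r s by auto
    then have "(1 - t) *\<^sub>R x + t *\<^sub>R x \<in> ?M" by (intro set_plus_intro imageI)
    then show "x \<in> ?M" by (simp add: algebra_simps)
  qed
  then have "0 \<in> interior ?M"
    using r s by (auto simp: mem_interior_cball intro!: exI[of _ "min r s"])
  moreover have "convex ?M"
    using A B by (auto simp: convex_body_o_def intro!: convex_set_plus convex_scaling)
  moreover have "?M = {x + y | x y. x \<in> (*\<^sub>R) (1 - t) ` A \<and> y \<in> (*\<^sub>R) t ` B}"
    by (auto simp: set_plus_def)
  then have "compact ?M"
    using A B by (auto simp: convex_body_o_def intro!: compact_sums compact_scaling)
  ultimately show ?thesis by (simp add: convex_body_o_def)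
qed

section \<open>Radial Gauss image of a polar body\<close>

text \<open>Both inclusions rest on pairs \<open>x\<close> in the polar body and \<open>y\<close> in
  \<open>M\<close> with \<open>x \<bullet> y = 1\<close>: then \<open>y\<close> is an outer normal
  of the polar body at \<open>x\<close>, and \<open>x\<close> is one of \<open>M\<close> at
  \<open>y\<close>.\<close>

lemma radial_gauss_image_polar_body:
  fixes M \<omega> :: "'a::euclidean_space set"
  assumes M: "convex_body_o M" and \<omega>: "\<omega> \<subseteq> sphere 0 1"
  shows "radial_gauss_image (polar_body M) \<omega> = (\<Union>u\<in>\<omega>. sgn ` support_face M u)"
proof (intro equalityI subsetI)
  have bipolar: "polar_body (polar_body M) = M"
    using M interior_subset
    by (intro polar_body_polar_body) (auto simp: convex_body_o_def compact_imp_closed)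
  fix v assume "v \<in> radial_gauss_image (polar_body M) \<omega>"
  then obtain s u where x: "s *\<^sub>R u \<in> frontier (polar_body M)" "0 < s" "u \<in> \<omega>"
    and v: "v \<in> unit_normals (polar_body M) (s *\<^sub>R u)"
    by (auto simp: radial_gauss_image_def)
  have xP: "s *\<^sub>R u \<in> polar_body M"
    using x(1) frontier_subset_closed[OF closed_polar_body] by blast
  have v1: "norm v = 1" and vle: "z \<bullet> v \<le> (s *\<^sub>R u) \<bullet> v" if "z \<in> polar_body M" for z
    using v that xP by (auto simp: unit_normals_def inner_diff)
  obtain r where r: "0 < r" "cball 0 r \<subseteq> polar_body M"
    using convex_body_o_polar_body[OF M] by (rule convex_body_oE)
  \<comment> \<open>\<open>h\<close> is the support value of the polar body in direction
    \<open>v\<close>, positive because 0 is an interior point. Scaling \<open>v\<close> by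
    \<open>1 / h\<close> yields the dual point \<open>y\<close>, which lies in \<open>M\<close> by
    bipolarity.\<close>
  define h where "h = (s *\<^sub>R u) \<bullet> v"
  have nv: "norm v = 1" using v1[OF xP] .
  have "r *\<^sub>R v \<in> polar_body M"
    using r nv by (intro subsetD[OF r(2)]) auto
  from vle[OF this] have h: "0 < h"
    using r nv by (simp add: norm_eq_1 h_def)
  define y where "y = (1 / h) *\<^sub>R v"
  have "z \<bullet> y \<le> 1" if "z \<in> polar_body M" for z
    using vle[OF that, folded h_def] h by (simp add: y_def)
  then have "y \<in> polar_body (polar_body M)"
    by (simp add: polar_body_def[of "polar_body M"])
  then have "y \<in> M"
    by (simp add: bipolar)
  moreover have "z \<bullet> u \<le> y \<bullet> u" if "z \<in> M" for z
  proof -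
    have "z \<bullet> (s *\<^sub>R u) \<le> 1" using xP that by (auto simp: polar_body_def)
    also have "1 = y \<bullet> (s *\<^sub>R u)" using h by (auto simp: y_def h_def inner_commute)
    finally show ?thesis using x(2) by simp
  qed
  moreover have "v = sgn y"
    using h nv by (simp add: y_def sgn_div_norm)
  ultimately show "v \<in> (\<Union>u\<in>\<omega>. sgn ` support_face M u)"
    using x(3) by (auto simp: support_face_def)
next
  fix v assume "v \<in> (\<Union>u\<in>\<omega>. sgn ` support_face M u)"
  then obtain u y where u: "u \<in> \<omega>" and y: "y \<in> support_face M u" "v = sgn y" by blast
  have u1: "norm u = 1" using u \<omega> by auto
  obtain r where r: "0 < r" "cball 0 r \<subseteq> M" using M by (rule convex_body_oE)
  \<comment> \<open>\<open>p\<close> is the support value of \<open>M\<close> in direction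
    \<open>u\<close>, so the ray through \<open>u\<close> leaves the polar body at distance
    \<open>1 / p\<close>.\<close>
  define p where "p = y \<bullet> u"
  have p: "0 < p"
    using support_face_ge[OF r(2) _ u1 y(1)] r by (simp add: p_def)
  define x where "x = (1 / p) *\<^sub>R u"
  have yM: "y \<in> M" and ymax: "\<And>z. z \<in> M \<Longrightarrow> z \<bullet> u \<le> p"
    using y by (auto simp: support_face_def p_def)
  have xP: "x \<in> polar_body M"
    using ymax p by (auto simp: polar_body_def x_def field_simps)
  have yx: "y \<bullet> x = 1" using p by (simp add: x_def p_def)
  have y0: "y \<noteq> 0" using yx by auto
  have le: "z \<bullet> y \<le> 1" if "z \<in> polar_body M" for z
    using that yM by (auto simp: polar_body_def inner_commute)
  \<comment> \<open>Equality \<open>y \<bullet> x = 1\<close> holds at \<open>x\<close>, so a small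
    move along \<open>y\<close> would violate \<open>le\<close>.\<close>
  have "x \<notin> interior (polar_body M)"
  proof
    assume "x \<in> interior (polar_body M)"
    then obtain e where e: "0 < e" "cball x e \<subseteq> polar_body M"
      by (auto simp: mem_interior_cball)
    have "x + e *\<^sub>R sgn y \<in> polar_body M"
      using e y0 by (intro subsetD[OF e(2)]) (simp add: dist_norm norm_sgn)
    from le[OF this] have "e * (sgn y \<bullet> y) \<le> 0"
      using yx by (simp add: inner_add inner_commute)
    moreover have "0 < sgn y \<bullet> y"
      using y0 by (simp add: sgn_div_norm)
    ultimately show False using e(1) by (simp add: mult_le_0_iff)
  qed
  then have "x \<in> frontier (polar_body M)"
    using xP closure_subset by (auto simp: frontier_def)
  moreover have "v \<in> unit_normals (polar_body M) x"
    using le yx y0 y(2)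
    by (auto simp: unit_normals_def norm_sgn inner_diff sgn_div_norm inner_commute
        intro!: mult_left_mono divide_right_mono)
  ultimately show "v \<in> radial_gauss_image (polar_body M) \<omega>"
    using u p by (auto simp: radial_gauss_image_def x_def intro!: bexI[of _ x] exI[of _ "1/p"])
qed

section \<open>Bounds in terms of the radii\<close>

text \<open>Each centred ball of radius \<open>R\<close> around \<open>K\<close> puts a ball of
  radius \<open>1 / R\<close> into the polar, hence \<open>1 / R \<le> a \<bullet> u\<close>. The
  reciprocal bound \<open>1 / (a \<bullet> u) \<le> R\<close> passes to the infimum.\<close>

lemma outradius_o_le:
  assumes "convex_body_o K" "norm u = 1" "a \<in> support_face (polar_body K) u"
  shows "0 < a \<bullet> u" "1 / outradius_o K \<le> a \<bullet> u" "0 < outradius_o K"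
proof -
  obtain R where R: "0 < R" "K \<subseteq> cball 0 R" using assms(1) by (rule convex_body_oE)
  have *: "1 / R \<le> a \<bullet> u" if "0 < R" "K \<subseteq> cball 0 R" for R
    using support_face_ge[OF cball_subset_polar_body _ assms(2,3)] that by simp
  have "0 < 1 / R" using R by simp
  with *[OF R] show pos: "0 < a \<bullet> u" by linarith
  \<comment> \<open>The set defining \<open>outradius_o\<close> allows \<open>R = 0\<close>, while
    \<open>*\<close> requires a positive radius; a nonzero point of \<open>K\<close> settles
    this.\<close>
  obtain r where r: "0 < r" "cball 0 r \<subseteq> K" using assms(1) by (rule convex_body_oE)
  have "r *\<^sub>R u \<in> K" using r assms(2) by (intro subsetD[OF r(2)]) auto
  then have Rpos: "0 < R" if "K \<subseteq> cball 0 R" for R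
    using that r assms(2) by (metis abs_of_pos mem_cball_0 mult.right_neutral norm_scaleR order_less_le_trans subsetD)
  have "1 / (a \<bullet> u) \<le> outradius_o K"
    unfolding outradius_o_def
  proof (rule cInf_greatest)
    show "{R. 0 \<le> R \<and> K \<subseteq> cball 0 R} \<noteq> {}" using R by (auto intro: less_imp_le)
    show "1 / (a \<bullet> u) \<le> R" if "R \<in> {R. 0 \<le> R \<and> K \<subseteq> cball 0 R}" for R
      using *[of R] Rpos[of R] that pos by (simp add: field_simps)
  qed
  moreover have "0 < 1 / (a \<bullet> u)" using pos by simp
  ultimately show Rk: "0 < outradius_o K" by linarith
  show "1 / outradius_o K \<le> a \<bullet> u"
    using \<open>1 / (a \<bullet> u) \<le> outradius_o K\<close> pos Rk by (simp add: field_simps)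
qed

text \<open>A nonzero \<open>a\<close> in the polar bounds all admissible radii by
  \<open>1 / norm a\<close>. This makes the supremum a genuine one and bounds it as well.\<close>

lemma inradius_o_ge:
  assumes "convex_body_o K" "a \<in> polar_body K" "a \<noteq> 0"
  shows "norm a \<le> 1 / inradius_o K" "0 < inradius_o K"
proof -
  have *: "r \<le> 1 / norm a" if "0 \<le> r" "cball 0 r \<subseteq> K" for r
    using norm_polar_body_le[OF that(2,1) assms(2)] assms(3) by (simp add: field_simps)
  obtain r where r: "0 < r" "cball 0 r \<subseteq> K" using assms(1) by (rule convex_body_oE)
  have "r \<le> inradius_o K"
    unfolding inradius_o_def using r *
    by (intro cSup_upper) (auto simp: bdd_above_def)
  then show pos: "0 < inradius_o K" using r by linarith
  have "inradius_o K \<le> 1 / norm a"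
    unfolding inradius_o_def using r *
    by (intro cSup_least) (auto intro: less_imp_le)
  then show "norm a \<le> 1 / inradius_o K"
    using pos assms(3) by (simp add: field_simps)
qed

section \<open>Lipschitz estimate\<close>

text \<open>The coefficients of \<open>y s\<close> and \<open>y t\<close> in terms of
  \<open>a\<close> and \<open>b\<close> form a matrix of determinant
  \<open>(1 - s) * t - s * (1 - t) = t - s\<close>, and Gram determinants scale by its
  square.\<close>

lemma gram_segment:
  fixes a b :: "'a::real_inner"
  defines "y \<equiv> \<lambda>t. (1 - t) *\<^sub>R a + t *\<^sub>R b"
  shows "(norm (y s))\<^sup>2 * (norm (y t))\<^sup>2 - (y s \<bullet> y t)\<^sup>2
    = (s - t)\<^sup>2 * ((norm a)\<^sup>2 * (norm b)\<^sup>2 - (a \<bullet> b)\<^sup>2)"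
  unfolding y_def power2_norm_eq_inner
  by (simp add: inner_add inner_commute[of b a]) (simp add: algebra_simps power2_eq_square)

text \<open>One half of the Hausdorff bound. The faces of the two polars in direction
  \<open>u\<close> do not depend on the parameter, so the \<open>u\<close>, \<open>a\<close>,
  \<open>b\<close> that produce \<open>v\<close> at \<open>s\<close> also produce a nearby normal at
  \<open>t\<close>.\<close>

lemma arc_dist_set_radial_gauss_image_le:
  fixes K L \<omega> :: "'a::euclidean_space set"
  assumes K: "convex_body_o K" and L: "convex_body_o L" and \<omega>: "\<omega> \<subseteq> sphere 0 1"
    and s: "0 \<le> s" "s \<le> 1" and t: "0 \<le> t" "t \<le> 1"
    and v: "v \<in> radial_gauss_image (harmonic_mean s K L) \<omega>"
  shows "arc_dist_set v (radial_gauss_image (harmonic_mean t K L) \<omega>)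
    \<le> ennreal (2 * max (outradius_o K / inradius_o K) (outradius_o L / inradius_o L)
                 * max (outradius_o K / inradius_o L) (outradius_o L / inradius_o K)
                 * \<bar>s - t\<bar>)"
proof -
  define A B where "A = polar_body K" and "B = polar_body L"
  define R where "R = max (outradius_o K) (outradius_o L)"
  have bodies: "convex_body_o A" "convex_body_o B"
    using K L by (simp_all add: A_def B_def convex_body_o_polar_body)
  then have AB: "compact A" "A \<noteq> {}" "compact B" "B \<noteq> {}"
    by (auto simp: convex_body_o_def)
  have image: "radial_gauss_image (harmonic_mean \<tau> K L) \<omega> =
      {sgn ((1 - \<tau>) *\<^sub>R a + \<tau> *\<^sub>R b) | u a b. u \<in> \<omega> \<and> a \<in> support_face A u \<and> b \<in> support_face B u}"
    if "0 \<le> \<tau>" "\<tau> \<le> 1" for \<tau>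
    unfolding harmonic_mean_def A_def[symmetric] B_def[symmetric]
      radial_gauss_image_polar_body[OF convex_body_o_minkowski[OF bodies that] \<omega>]
      support_face_minkowski[OF AB that] by blast
  obtain u a b where u: "u \<in> \<omega>" and a: "a \<in> support_face A u" and b: "b \<in> support_face B u"
    and v_eq: "v = sgn ((1 - s) *\<^sub>R a + s *\<^sub>R b)"
    using v unfolding image[OF s] by blast
  define y where "y = (\<lambda>\<tau>. (1 - \<tau>) *\<^sub>R a + \<tau> *\<^sub>R b)"
  have u1: "norm u = 1" using u \<omega> by auto
  note RK = outradius_o_le[OF K u1 a[unfolded A_def]]
  note RL = outradius_o_le[OF L u1 b[unfolded B_def]]
  have "a \<noteq> 0" "b \<noteq> 0" using RK(1) RL(1) by auto
  moreover have "a \<in> polar_body K" "b \<in> polar_body L"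
    using a b by (auto simp: support_face_def A_def B_def)
  ultimately have rK: "norm a \<le> 1 / inradius_o K" "0 < inradius_o K"
    and rL: "norm b \<le> 1 / inradius_o L" "0 < inradius_o L"
    using inradius_o_ge[OF K] inradius_o_ge[OF L] by blast+
  have R: "0 < R" "1 / R \<le> a \<bullet> u" "1 / R \<le> b \<bullet> u"
  proof -
    show R0: "0 < R" using RK(3) by (simp add: R_def)
    have "1 / R \<le> 1 / outradius_o K" "1 / R \<le> 1 / outradius_o L"
      using RK(3) RL(3) R0 by (auto simp: R_def intro!: divide_left_mono mult_pos_pos)
    then show "1 / R \<le> a \<bullet> u" "1 / R \<le> b \<bullet> u"
      using RK(2) RL(2) by linarith+
  qed
  \<comment> \<open>Negation turns the upper bound for convex combinations into the lower bound
    wanted here.\<close>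
  have yu: "1 / R \<le> y \<tau> \<bullet> u" if "0 \<le> \<tau>" "\<tau> \<le> 1" for \<tau>
    using convex_bound_le[of "- (a \<bullet> u)" "- (1 / R)" "- (b \<bullet> u)" "1 - \<tau>" \<tau>] R that
    by (simp add: y_def inner_add)
  define D where "D = \<bar>s - t\<bar> * (norm a * norm b)"
  \<comment> \<open>Dropping \<open>(a \<bullet> b)\<^sup>2\<close> bounds the parallelogram area by
    the product of the side lengths.\<close>
  have "(norm (y s))\<^sup>2 * (norm (y t))\<^sup>2 - (y s \<bullet> y t)\<^sup>2 \<le> D\<^sup>2"
    unfolding y_def gram_segment D_def
    by (simp add: power_mult_distrib mult_left_mono)
  from arc_dist_sgn_le[OF u1 _ yu[OF s] yu[OF t] _ this] R(1)
  have "arc_dist (sgn (y s)) (sgn (y t)) \<le> 2 * R\<^sup>2 * (norm a * norm b) * \<bar>s - t\<bar>"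
    by (simp add: D_def power_divide mult_ac)
  also have "\<dots> \<le> 2 * R\<^sup>2 * (1 / inradius_o K * (1 / inradius_o L)) * \<bar>s - t\<bar>"
    using rK rL by (intro mult_mono mult_left_mono mult_right_mono) auto
  also have "\<dots> = 2 * ((R / inradius_o K) * (R / inradius_o L)) * \<bar>s - t\<bar>"
    by (simp add: power2_eq_square)
  also have "\<dots> \<le> 2 * (max (outradius_o K / inradius_o K) (outradius_o L / inradius_o L)
      * max (outradius_o K / inradius_o L) (outradius_o L / inradius_o K)) * \<bar>s - t\<bar>"
  proof (intro mult_right_mono mult_left_mono)
    \<comment> \<open>Whichever outradius equals \<open>R\<close>, its quotient by the inradius of
      the same body occurs in the first maximum and the mixed quotient in the second. If
      \<open>L\<close> has the larger outradius, the factors must be swapped first.\<close>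
    show "(R / inradius_o K) * (R / inradius_o L) \<le>
       max (outradius_o K / inradius_o K) (outradius_o L / inradius_o L)
      * max (outradius_o K / inradius_o L) (outradius_o L / inradius_o K)"
    proof (cases "outradius_o L \<le> outradius_o K")
      case True
      then show ?thesis
        using RK(3) rK(2) rL(2)
        by (intro mult_mono) (auto simp: R_def max_absorb1 intro: le_max_iff_disj[THEN iffD2])
    next
      case False
      then show ?thesis
        using RL(3) rK(2) rL(2) unfolding mult.commute[of "R / inradius_o K"]
        by (intro mult_mono) (auto simp: R_def max_absorb2 intro: le_max_iff_disj[THEN iffD2])
    qed
  qed auto
  finally have le: "arc_dist v (sgn (y t)) \<le>
      2 * max (outradius_o K / inradius_o K) (outradius_o L / inradius_o L)
        * max (outradius_o K / inradius_o L) (outradius_o L / inradius_o K) * \<bar>s - t\<bar>"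
    by (simp add: v_eq y_def mult.assoc)
  have "sgn (y t) \<in> radial_gauss_image (harmonic_mean t K L) \<omega>"
    unfolding image[OF t] y_def using u a b by blast
  then have "arc_dist_set v (radial_gauss_image (harmonic_mean t K L) \<omega>)
      \<le> ennreal (arc_dist v (sgn (y t)))"
    unfolding arc_dist_set_def by (rule INF_lower)
  also have "\<dots> \<le> ennreal (2 * max (outradius_o K / inradius_o K) (outradius_o L / inradius_o L)
        * max (outradius_o K / inradius_o L) (outradius_o L / inradius_o K) * \<bar>s - t\<bar>)"
    by (rule ennreal_leI[OF le])
  finally show ?thesis .
qed

theorem proposition3p7:
  fixes K L \<omega> :: "(real ^ 'n) set" and t1 t2 :: real
  assumes "convex_body_o K" and "convex_body_o L"
    and "\<omega> \<subseteq> sphere 0 1"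
    and "t1 \<in> {0..1}" and "t2 \<in> {0..1}"
  shows "arc_hausdorff_dist (radial_gauss_image (harmonic_mean t1 K L) \<omega>)
                            (radial_gauss_image (harmonic_mean t2 K L) \<omega>)
    \<le> ennreal (2 * max (outradius_o K / inradius_o K) (outradius_o L / inradius_o L)
                 * max (outradius_o K / inradius_o L) (outradius_o L / inradius_o K)
                 * \<bar>t1 - t2\<bar>)"
proof -
  have t: "0 \<le> t1" "t1 \<le> 1" "0 \<le> t2" "t2 \<le> 1" using assms(4,5) by auto
  note bound = arc_dist_set_radial_gauss_image_le[OF assms(1-3)]
  show ?thesis
    \<comment> \<open>The one-sided bound is symmetric in the two parameters, so applying it in both
      orders bounds both suprema.\<close>
    unfolding arc_hausdorff_dist_def
    using bound[OF t] bound[OF t(3,4,1,2)]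
    by (simp only: abs_minus_commute[of t2 t1]) (intro max.boundedI SUP_least)
qed

end
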